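(* Let $G=C_2^r\oplus C_4^t$, where $r\in\mathbb N_0$ and $t\in\mathbb N$. Let $\mathcal C=\mathcal C(\mathcal B_\pm(G),\mathcal F(G))$ be the class semigroup of $\mathcal B_\pm(G)$ in $\mathcal F(G)$, and for $S\in\mathcal F(G)$ let $[S]\in\mathcal C$ denote its class. 1. For $S\in\mathcal F(G)$ the following are equivalent: (a) $[S]\in\mathsf E(\mathcal C)$; (b) $S\in\mathcal B_\pm(G)$; (c) $\sigma_\pm(S)$ is a subgroup of $2G$. 2. Let $S_1,S_2\in\mathcal B_\pm(G)$. Then $[S_1]\le[S_2]$ (in the Rees order of $\mathsf E(\mathcal C)$) if and only if $\sigma_\pm(S_1)\supset\sigma_\pm(S_2)$. Moreover, $\mathcal C_{[S_1]}=\mathcal C_{[S_2]}$ if and only if $\sigma_\pm(S_1)=\sigma_\pm(S_2)$. 3. $\mathcal C$ is a Clifford semigroup and $\{\mathcal C_{[S]}:S\in\mathcal B_\pm(G)\}$ is the set of its constituent groups. 4. Let $G_1\subset 2G$ be a subgroup, let $g_1,\dots,g_s\in G$ be such that $(2g_1,\dots,2g_s)$ is a basis of $G_1$, and set $S_0=g_1^2\cdot\ldots\cdot g_s^2\in\mathcal B_\pm(G)$. Then $\sigma_\pm(S_0)=G_1$ and $$\mathcal C_{[S_0]}=[S_0]+\bigl\{[g]:g\in G\text{ such that }2g\in G_1\bigr\}\cong C_2^{r+t}.$$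
   Context: $G$ is written additively; $C_n$ is a cyclic group of order $n$; $2G=\{2g:g\in G\}$. $\mathcal F(G)$ is the (multiplicative) free abelian monoid with basis $G$. For $S=g_1\cdot\ldots\cdot g_\ell\in\mathcal F(G)$, $\sigma_\pm(S)=\{\varepsilon_1g_1+\dots+\varepsilon_\ell g_\ell:\varepsilon_i\in\{1,-1\}\}$ (so $\sigma_\pm(1)=\{0\}$), and $\mathcal B_\pm(G)=\{S\in\mathcal F(G):0\in\sigma_\pm(S)\}$. A tuple $(e_1,\dots,e_s)$ of nonzero elements is a basis of an abelian group if it generates the group and $\sum m_ie_i=0$ with $m_i\in\mathbb Z$ implies $m_ie_i=0$ for all $i$ (the empty tuple is a basis of the trivial group). **Class semigroup.** For a submonoid $H$ of $F=\mathcal F(G)$, elements $y,y'\in F$ are $H$-equivalent if for all $x\in F$: $xy\in H\iff xy'\in H$. This is a congruence relation on $F$; the class of $y$ is $[y]$, and $\mathcal C(H,F)=\{[y]:y\in F\}$ is a commutative semigroup, written additively ($[y]+[y']=[yy']$), with zero element $[1]$. **Finite commutative semigroups.** For an additive finite commutative semigroup $\mathcal C$ with zero element, $\mathsf E(\mathcal C)$ is the set of idempotents ($e+e=e$), ordered by the Rees order: $e\le f$ iff $e+f=e$. For $e\in\mathsf E(\mathcal C)$ the constituent group $\mathcal C_e$ is the set of all $x\in\mathcal C$ with $x+e=x$ and $x+y=e$ for some $y\in\mathcal C$; it is a group with identity $e$. $\mathcal C$ is a Clifford semigroup if it is a union of groups, equivalently $\mathcal C=\biguplus_{e\in\mathsf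 E(\mathcal C)}\mathcal C_e$. *)

theory Defs
  imports
    "HOL-Algebra.Product_Groups"
    "HOL-Algebra.Elementary_Groups"
    "HOL-Algebra.FiniteProduct"
    "HOL-Library.Multiset"
begin

(* All groups and semigroups, including those that the mathematics writes additively,
   use the multiplicative notation of HOL-Algebra: g + h is g \<otimes> h, 0 is \<one>, and
   m g is g [^] m. *)

definition cyclic_power :: "nat \<Rightarrow> nat \<Rightarrow> (nat \<Rightarrow> int) monoid" where
  \<comment> \<open>the direct sum of r copies of the cyclic group of order n\<close>
  "cyclic_power n r = product_group {..<r} (\<lambda>_. integer_mod_group n)"

definition doubles :: "('a, 'b) monoid_scheme \<Rightarrow> 'a set" where
  \<comment> \<open>2G\<close>
  "doubles G = {g \<otimes>\<^bsub>G\<^esub> g | g. g \<in> carrier G}"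

definition is_basis :: "('a, 'b) monoid_scheme \<Rightarrow> 'a list \<Rightarrow> bool" where
  "is_basis G es \<longleftrightarrow>
     set es \<subseteq> carrier G - {\<one>\<^bsub>G\<^esub>} \<and>
     generate G (set es) = carrier G \<and>
     (\<forall>m :: nat \<Rightarrow> int.
        (\<Otimes>\<^bsub>G\<^esub>i\<in>{..<length es}. (es ! i) [^]\<^bsub>G\<^esub> m i) = \<one>\<^bsub>G\<^esub> \<longrightarrow>
        (\<forall>i < length es. (es ! i) [^]\<^bsub>G\<^esub> m i = \<one>\<^bsub>G\<^esub>))"

definition seq_monoid :: "('a, 'b) monoid_scheme \<Rightarrow> 'a multiset monoid" where
  \<comment> \<open>the free abelian monoid F(G); the product of two sequences is the multiset sum\<close>
  "seq_monoid G = \<lparr>carrier = {S. set_mset S \<subseteq> carrier G}, monoid.mult = (+), one = {#}\<rparr>"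

definition pm_sums :: "('a, 'b) monoid_scheme \<Rightarrow> 'a multiset \<Rightarrow> 'a set" where
  \<comment> \<open>the set of plus-minus weighted sums of S; the list gs enumerates the terms of S\<close>
  "pm_sums G S =
     {\<Otimes>\<^bsub>G\<^esub>i\<in>{..<length gs}. (gs ! i) [^]\<^bsub>G\<^esub> \<epsilon> i | gs (\<epsilon> :: nat \<Rightarrow> int).
        mset gs = S \<and> (\<forall>i < length gs. \<epsilon> i \<in> {1, -1})}"

definition pm_zero_sum :: "('a, 'b) monoid_scheme \<Rightarrow> 'a multiset set" where
  "pm_zero_sum G = {S \<in> carrier (seq_monoid G). \<one>\<^bsub>G\<^esub> \<in> pm_sums G S}"

definition H_equiv :: "('f, 'b) monoid_scheme \<Rightarrow> 'f set \<Rightarrow> ('f \<times> 'f) set" where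
  "H_equiv F H = {(y, y'). y \<in> carrier F \<and> y' \<in> carrier F \<and>
     (\<forall>x \<in> carrier F. x \<otimes>\<^bsub>F\<^esub> y \<in> H \<longleftrightarrow> x \<otimes>\<^bsub>F\<^esub> y' \<in> H)}"

definition H_class :: "('f, 'b) monoid_scheme \<Rightarrow> 'f set \<Rightarrow> 'f \<Rightarrow> 'f set" where
  "H_class F H y = H_equiv F H `` {y}"

definition class_semigroup :: "'f set \<Rightarrow> ('f, 'b) monoid_scheme \<Rightarrow> 'f set monoid" where
  \<comment> \<open>the union in the product ranges over equal classes, see \<open>class_semigroup_mult\<close>\<close>
  "class_semigroup H F =
     \<lparr>carrier = carrier F // H_equiv F H,
      monoid.mult = (\<lambda>A B. \<Union>a\<in>A. \<Union>b\<in>B. H_class F H (a \<otimes>\<^bsub>F\<^esub> b)),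
      one = H_class F H \<one>\<^bsub>F\<^esub>\<rparr>"

lemma equiv_H_equiv: "equiv (carrier F) (H_equiv F H)"
  by (rule equivI) (auto simp: H_equiv_def refl_on_def sym_def trans_def)

lemma (in comm_monoid) H_equiv_mult:
  assumes "(a, a') \<in> H_equiv G H" "(b, b') \<in> H_equiv G H"
  shows "(a \<otimes> b, a' \<otimes> b') \<in> H_equiv G H"
proof -
  have car: "a \<in> carrier G" "a' \<in> carrier G" "b \<in> carrier G" "b' \<in> carrier G"
    using assms by (auto simp: H_equiv_def)
  have "x \<otimes> (a \<otimes> b) \<in> H \<longleftrightarrow> x \<otimes> (a' \<otimes> b') \<in> H" if x: "x \<in> carrier G" for x
  proof -
    have "x \<otimes> (a \<otimes> b) = (x \<otimes> b) \<otimes> a" "(x \<otimes> b) \<otimes> a' = (x \<otimes> a') \<otimes> b"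
      "x \<otimes> (a' \<otimes> b') = (x \<otimes> a') \<otimes> b'"
      using x car by (simp_all add: m_ac)
    moreover have "(x \<otimes> b) \<otimes> a \<in> H \<longleftrightarrow> (x \<otimes> b) \<otimes> a' \<in> H"
      "(x \<otimes> a') \<otimes> b \<in> H \<longleftrightarrow> (x \<otimes> a') \<otimes> b' \<in> H"
      using x car assms by (auto simp: H_equiv_def)
    ultimately show ?thesis by simp
  qed
  then show ?thesis using car by (auto simp: H_equiv_def)
qed

lemma (in comm_monoid) class_semigroup_mult:
  assumes "y \<in> carrier G" "y' \<in> carrier G"
  shows "H_class G H y \<otimes>\<^bsub>class_semigroup H G\<^esub> H_class G H y' = H_class G H (y \<otimes> y')"
proof -
  have eq: "H_class G H (a \<otimes> b) = H_class G H (y \<otimes> y')"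
    if "a \<in> H_class G H y" "b \<in> H_class G H y'" for a b
  proof -
    have "(y \<otimes> y', a \<otimes> b) \<in> H_equiv G H"
      using that by (intro H_equiv_mult) (simp_all add: H_class_def)
    then show ?thesis
      unfolding H_class_def by (rule equiv_class_eq[OF equiv_H_equiv, symmetric])
  qed
  have "y \<in> H_class G H y" "y' \<in> H_class G H y'"
    using assms by (auto simp: H_class_def H_equiv_def)
  then have "(\<Union>a \<in> H_class G H y. \<Union>b \<in> H_class G H y'. H_class G H (a \<otimes> b)) = H_class G H (y \<otimes> y')"
    using eq by blast
  then show ?thesis by (simp add: class_semigroup_def)
qed

definition idempotents :: "('c, 'b) monoid_scheme \<Rightarrow> 'c set" where
  "idempotents C = {e \<in> carrier C. e \<otimes>\<^bsub>C\<^esub> e = e}"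

definition rees_le :: "('c, 'b) monoid_scheme \<Rightarrow> 'c \<Rightarrow> 'c \<Rightarrow> bool" where
  "rees_le C e f \<longleftrightarrow> e \<in> idempotents C \<and> f \<in> idempotents C \<and> e \<otimes>\<^bsub>C\<^esub> f = e"

definition constituent :: "('c, 'b) monoid_scheme \<Rightarrow> 'c \<Rightarrow> 'c set" where
  "constituent C e =
     {x \<in> carrier C. x \<otimes>\<^bsub>C\<^esub> e = x \<and> (\<exists>y \<in> carrier C. x \<otimes>\<^bsub>C\<^esub> y = e)}"

definition subsemigroup_at :: "('c, 'b) monoid_scheme \<Rightarrow> 'c set \<Rightarrow> 'c \<Rightarrow> ('c, 'b) monoid_scheme" where
  \<comment> \<open>the subset A of C with the operation of C and with identity e instead of that of C\<close>
  "subsemigroup_at C A e = C\<lparr>carrier := A, one := e\<rparr>"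

definition clifford_semigroup :: "('c, 'b) monoid_scheme \<Rightarrow> bool" where
  \<comment> \<open>a finite commutative semigroup with zero element that is a union of groups\<close>
  "clifford_semigroup C \<longleftrightarrow>
     comm_monoid C \<and> finite (carrier C) \<and>
     (\<exists>\<A>. (\<forall>A \<in> \<A>. \<exists>e. group (subsemigroup_at C A e)) \<and> carrier C = \<Union>\<A>)"

abbreviation pm_class_semigroup :: "('a, 'b) monoid_scheme \<Rightarrow> 'a multiset set monoid" where
  "pm_class_semigroup G \<equiv> class_semigroup (pm_zero_sum G) (seq_monoid G)"

abbreviation pm_class :: "('a, 'b) monoid_scheme \<Rightarrow> 'a multiset \<Rightarrow> 'a multiset set" where
  "pm_class G S \<equiv> H_class (seq_monoid G) (pm_zero_sum G) S"

end

theory Submission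
  imports Defs "HOL-Combinatorics.Permutations"
begin

text \<open>
  In any abelian group two sequences are equivalent iff they have the same set of plus-minus sums
  (\<open>H_equiv_pm_zero_sum\<close>): an element \<open>h\<close> is a sum of \<open>S\<close> iff \<open>h\<close> completes \<open>S\<close> to a zero-sum
  sequence. Sets of sums are added elementwise when sequences are multiplied, so the class
  semigroup is a semigroup of subsets of the group.

  If the exponent divides four, this semigroup becomes explicit (\<open>pm_sums_eq_coset\<close>). A sign
  change alters a sum by \<open>2g\<close>, an element of order at most two, so the sums of \<open>S\<close> form a coset
  \<open>a + K\<close>, where \<open>K\<close> is the span of the doubles of the terms of \<open>S\<close> and \<open>2a \<in> K\<close>. Hence
  \<open>(a + K) + (a + K) = K\<close> and \<open>3(a + K) = a + K\<close>. The idempotents are therefore the subgroups \<open>K\<close>,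
  which are the cosets that contain \<open>0\<close>, and the Rees order on them is reverse inclusion because
  the sum of two subgroups equals the first iff it contains the second. A commutative semigroup
  in which \<open>x\<^sup>3 = x\<close> is a Clifford semigroup whose constituent group at \<open>e\<close> is \<open>{x. x\<^sup>2 = e}\<close>, in
  particular an elementary 2-group (\<open>constituent_eq_square_roots\<close>).

  The constituent group at \<open>K\<close> thus consists of the cosets \<open>a + K\<close> with \<open>2a \<in> K\<close>. As \<open>K\<close>
  consists of doubles, doubling maps \<open>{a. 2a \<in> K}\<close> onto \<open>K\<close>, with kernel the 2-torsion
  \<open>G[2]\<close>, so there are \<open>|G[2]|\<close> such cosets, and an elementary 2-group is determined by its order (\<open>iso_cyclic_power_2\<close>). For
  \<open>C\<^sub>2\<^sup>r \<oplus> C\<^sub>4\<^sup>t\<close> the order of \<open>G[2]\<close> is \<open>2\<^bsup>r + t\<^esup>\<close>.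

  The comments write the group \<open>G\<close> additively, as above, although the formulas use the
  multiplicative notation.
\<close>

section \<open>Classes of sequences and their plus-minus sums\<close>

lemma carrier_seq_monoid [simp]: "S \<in> carrier (seq_monoid G) \<longleftrightarrow> set_mset S \<subseteq> carrier G"
  by (simp add: seq_monoid_def)

lemma mult_seq_monoid [simp]: "S \<otimes>\<^bsub>seq_monoid G\<^esub> T = S + T"
  by (simp add: seq_monoid_def)

lemma one_seq_monoid [simp]: "\<one>\<^bsub>seq_monoid G\<^esub> = {#}"
  by (simp add: seq_monoid_def)

lemma comm_monoid_seq_monoid: "comm_monoid (seq_monoid G)"
  by (rule comm_monoidI) (auto simp: ac_simps)

context comm_group
begin

text \<open>A single enumeration of the sequence suffices: for another enumeration, the signs are
  carried along by the permutation that relates the two.\<close>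

lemma pm_sums_mset:
  assumes "set gs \<subseteq> carrier G"
  shows "pm_sums G (mset gs) =
    {\<Otimes>i\<in>{..<length gs}. (gs ! i) [^] \<epsilon> i | \<epsilon> :: nat \<Rightarrow> int. \<forall>i < length gs. \<epsilon> i \<in> {1, -1}}"
    (is "_ = ?P gs")
proof
  show "?P gs \<subseteq> pm_sums G (mset gs)"
    unfolding pm_sums_def by blast
  show "pm_sums G (mset gs) \<subseteq> ?P gs"
  proof
    fix x assume "x \<in> pm_sums G (mset gs)"
    then obtain hs and \<epsilon> :: "nat \<Rightarrow> int" where x: "x = (\<Otimes>i\<in>{..<length hs}. (hs ! i) [^] \<epsilon> i)"
      and hs: "mset hs = mset gs" and \<epsilon>: "\<forall>i < length hs. \<epsilon> i \<in> {1, -1}"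
      unfolding pm_sums_def by blast
    obtain p where p: "p permutes {..<length hs}" and gs: "permute_list p hs = gs"
      using mset_eq_permutation[OF hs[symmetric]] by auto
    have len: "length gs = length hs" using gs by auto
    have img: "p ` {..<length hs} = {..<length hs}" by (rule permutes_image[OF p])
    have in_carrier: "hs ! i \<in> carrier G" if "i < length hs" for i
      using assms mset_eq_setD[OF hs] that nth_mem by blast
    have "x = (\<Otimes>i\<in>p ` {..<length hs}. (hs ! i) [^] \<epsilon> i)"
      by (simp only: img x)
    also have "\<dots> = (\<Otimes>i\<in>{..<length hs}. (hs ! p i) [^] \<epsilon> (p i))"
      by (rule finprod_reindex) (use in_carrier img permutes_inj_on[OF p] in auto)
    also have "\<dots> = (\<Otimes>i\<in>{..<length gs}. (gs ! i) [^] \<epsilon> (p i))"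
      unfolding len
      by (rule finprod_cong')
         (use in_carrier permutes_in_image[OF p] permute_list_nth[OF p] gs in auto)
    finally show "x \<in> ?P gs"
      using \<epsilon> img len by (intro CollectI exI[of _ "\<lambda>i. \<epsilon> (p i)"]) auto
  qed
qed

lemma pm_sums_empty: "pm_sums G {#} = {\<one>}"
  using pm_sums_mset[of "[]"] by simp

lemma pm_sums_add_mset:
  assumes g: "g \<in> carrier G" and S: "set_mset S \<subseteq> carrier G"
  shows "pm_sums G (add_mset g S) = (g <# pm_sums G S) \<union> (inv g <# pm_sums G S)"
proof -
  obtain gs where gs: "S = mset gs" by (metis ex_mset)
  have gs_carrier: "set gs \<subseteq> carrier G" using S gs by simp
  have nth: "gs ! i \<in> carrier G" if "i < length gs" for i using gs_carrier that by auto
  have split: "(\<Otimes>i\<in>{..<length (g # gs)}. ((g # gs) ! i) [^] \<epsilon> i)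
      = g [^] \<epsilon> 0 \<otimes> (\<Otimes>i\<in>{..<length gs}. (gs ! i) [^] \<epsilon> (Suc i))" for \<epsilon> :: "nat \<Rightarrow> int"
  proof -
    have "(\<Otimes>i\<in>Suc ` {..<length gs}. ((g # gs) ! i) [^] \<epsilon> i)
        = (\<Otimes>i\<in>{..<length gs}. ((g # gs) ! Suc i) [^] \<epsilon> (Suc i))"
      by (rule finprod_reindex) (use nth in auto)
    moreover have "(\<Otimes>i\<in>insert 0 (Suc ` {..<length gs}). ((g # gs) ! i) [^] \<epsilon> i)
        = g [^] \<epsilon> 0 \<otimes> (\<Otimes>i\<in>Suc ` {..<length gs}. ((g # gs) ! i) [^] \<epsilon> i)"
      by (subst finprod_insert) (use nth g in auto)
    ultimately show ?thesis
      by (simp add: lessThan_Suc_eq_insert_0)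
  qed
  have sums_gs: "pm_sums G S = {\<Otimes>i\<in>{..<length gs}. (gs ! i) [^] \<epsilon> i | \<epsilon> :: nat \<Rightarrow> int.
      \<forall>i < length gs. \<epsilon> i \<in> {1, -1}}"
    using pm_sums_mset[OF gs_carrier] gs by simp
  have sums_Cons: "pm_sums G (add_mset g S) = {g [^] \<epsilon> 0 \<otimes> (\<Otimes>i\<in>{..<length gs}. (gs ! i) [^] \<epsilon> (Suc i)) |
      \<epsilon> :: nat \<Rightarrow> int. \<forall>i < Suc (length gs). \<epsilon> i \<in> {1, -1}}"
    using pm_sums_mset[of "g # gs"] gs_carrier g gs split by simp
  have powers: "g [^] (1::int) = g" "g [^] (-1::int) = inv g"
    using g by (simp_all add: int_pow_neg)
  show ?thesis
  proof (intro equalityI subsetI)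
    fix x assume "x \<in> pm_sums G (add_mset g S)"
    then obtain \<epsilon> :: "nat \<Rightarrow> int"
      where x: "x = g [^] \<epsilon> 0 \<otimes> (\<Otimes>i\<in>{..<length gs}. (gs ! i) [^] \<epsilon> (Suc i))"
        and \<epsilon>: "\<forall>i < Suc (length gs). \<epsilon> i \<in> {1, -1}"
      unfolding sums_Cons by blast
    have "(\<Otimes>i\<in>{..<length gs}. (gs ! i) [^] \<epsilon> (Suc i)) \<in> pm_sums G S"
      unfolding sums_gs using \<epsilon> by (intro CollectI exI[of _ "\<lambda>i. \<epsilon> (Suc i)"]) auto
    moreover have "\<epsilon> 0 \<in> {1, -1}" using \<epsilon> by blast
    ultimately show "x \<in> (g <# pm_sums G S) \<union> (inv g <# pm_sums G S)"
      using x powers by (auto simp: l_coset_def)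
  next
    fix x assume "x \<in> (g <# pm_sums G S) \<union> (inv g <# pm_sums G S)"
    then obtain e :: int and y where e: "e \<in> {1, -1}" and y: "y \<in> pm_sums G S" and x: "x = g [^] e \<otimes> y"
      unfolding l_coset_def using powers by (metis (no_types, lifting) UN_E Un_iff insertCI singletonD)
    obtain \<epsilon> :: "nat \<Rightarrow> int" where "y = (\<Otimes>i\<in>{..<length gs}. (gs ! i) [^] \<epsilon> i)"
        and "\<forall>i < length gs. \<epsilon> i \<in> {1, -1}"
      using y unfolding sums_gs by blast
    then show "x \<in> pm_sums G (add_mset g S)"
      unfolding sums_Cons using x e
      by (intro CollectI exI[of _ "case_nat e \<epsilon>"]) (auto simp: less_Suc_eq_0_disj)
  qed
qed

lemma pm_sums_closed:
  assumes "set_mset S \<subseteq> carrier G"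
  shows "pm_sums G S \<subseteq> carrier G"
  using assms
  by (induction S) (auto simp: pm_sums_empty pm_sums_add_mset l_coset_def)

text \<open>Reversing all signs negates a plus-minus sum.\<close>

lemma inv_pm_sums:
  assumes "set_mset S \<subseteq> carrier G" "x \<in> pm_sums G S"
  shows "inv x \<in> pm_sums G S"
  using assms
proof (induction S arbitrary: x)
  case empty
  then show ?case by (simp add: pm_sums_empty)
next
  case (add g S)
  then have g: "g \<in> carrier G" and S: "set_mset S \<subseteq> carrier G" by auto
  obtain y where y: "y \<in> pm_sums G S" and x: "x = g \<otimes> y \<or> x = inv g \<otimes> y"
    using add.prems(2) unfolding pm_sums_add_mset[OF g S] l_coset_def by blast
  have "y \<in> carrier G" using y pm_sums_closed[OF S] by blast
  then have "inv x = inv g \<otimes> inv y \<or> inv x = g \<otimes> inv y"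
    using x g by (auto simp: inv_mult)
  then show ?case
    unfolding pm_sums_add_mset[OF g S] l_coset_def using add.IH[OF S y] by blast
qed

lemma pm_sums_union:
  assumes S: "set_mset S \<subseteq> carrier G" and T: "set_mset T \<subseteq> carrier G"
  shows "pm_sums G (S + T) = pm_sums G S <#> pm_sums G T"
  using S
proof (induction S)
  case empty
  then show ?case
    using pm_sums_closed[OF T] lcos_mult_one by (simp add: pm_sums_empty l_coset_eq_set_mult[symmetric])
next
  case (add g S)
  then have g: "g \<in> carrier G" and S: "set_mset S \<subseteq> carrier G" by auto
  have ST: "set_mset (S + T) \<subseteq> carrier G" using S T by simp
  have dist: "h <# (pm_sums G S <#> pm_sums G T) = (h <# pm_sums G S) <#> pm_sums G T"
    if "h \<in> carrier G" for h
    using that pm_sums_closed[OF S] pm_sums_closed[OF T] by (simp add: setmult_lcos_assoc)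
  have "pm_sums G (add_mset g S + T) = (g <# pm_sums G (S + T)) \<union> (inv g <# pm_sums G (S + T))"
    using pm_sums_add_mset[OF g ST] by simp
  also have "\<dots> = ((g <# pm_sums G S) <#> pm_sums G T) \<union> ((inv g <# pm_sums G S) <#> pm_sums G T)"
    using add.IH[OF S] dist g by simp
  also have "\<dots> = pm_sums G (add_mset g S) <#> pm_sums G T"
    unfolding pm_sums_add_mset[OF g S] set_mult_def by blast
  finally show ?case .
qed

lemma pm_zero_sum_iff:
  "S \<in> pm_zero_sum G \<longleftrightarrow> set_mset S \<subseteq> carrier G \<and> \<one> \<in> pm_sums G S"
  by (simp add: pm_zero_sum_def)

text \<open>The terms that complete a sequence to a plus-minus zero-sum sequence are exactly its
  plus-minus sums: \<open>h\<close> completes \<open>S\<close> iff \<open>h\<close> or \<open>-h\<close> is a sum of \<open>S\<close>, and the set of sums is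
  closed under negation.\<close>

lemma mem_pm_sums_iff:
  assumes S: "set_mset S \<subseteq> carrier G" and h: "h \<in> carrier G"
  shows "h \<in> pm_sums G S \<longleftrightarrow> add_mset h S \<in> pm_zero_sum G"
proof -
  have "\<one> \<in> h' <# pm_sums G S \<longleftrightarrow> inv h' \<in> pm_sums G S" if h': "h' \<in> carrier G" for h'
  proof
    assume "\<one> \<in> h' <# pm_sums G S"
    then obtain y where y: "y \<in> pm_sums G S" "h' \<otimes> y = \<one>"
      unfolding l_coset_def by auto
    then have "y \<otimes> h' = \<one>" using h' pm_sums_closed[OF S] m_comm[of h' y] by auto
    then have "inv h' = y" using h' y(1) pm_sums_closed[OF S] by (intro inv_equality) auto
    then show "inv h' \<in> pm_sums G S" using y(1) by simp
  next
    assume "inv h' \<in> pm_sums G S"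
    then have "h' \<otimes> inv h' \<in> h' <# pm_sums G S" unfolding l_coset_def by blast
    then show "\<one> \<in> h' <# pm_sums G S" using h' by simp
  qed
  then show ?thesis
    using S h inv_pm_sums[OF S]
    by (auto simp: pm_zero_sum_iff pm_sums_add_mset) (metis inv_inv)
qed

text \<open>Sequences of length one already separate classes: by \<open>mem_pm_sums_iff\<close> they recover the whole set of
  sums. Conversely that set determines which extensions are zero-sum, because it is
  multiplicative.\<close>

lemma H_equiv_pm_zero_sum:
  "(S, T) \<in> H_equiv (seq_monoid G) (pm_zero_sum G) \<longleftrightarrow>
     set_mset S \<subseteq> carrier G \<and> set_mset T \<subseteq> carrier G \<and> pm_sums G S = pm_sums G T"
proof (intro iffI conjI)
  assume equiv: "(S, T) \<in> H_equiv (seq_monoid G) (pm_zero_sum G)"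
  then show S: "set_mset S \<subseteq> carrier G" and T: "set_mset T \<subseteq> carrier G"
    by (auto simp: H_equiv_def)
  have "h \<in> pm_sums G S \<longleftrightarrow> h \<in> pm_sums G T" if h: "h \<in> carrier G" for h
  proof -
    have "{#h#} + S \<in> pm_zero_sum G \<longleftrightarrow> {#h#} + T \<in> pm_zero_sum G"
      using equiv h unfolding H_equiv_def
      by (auto simp del: add_mset_add_single union_mset_add_mset_left dest!: bspec[where x = "{#h#}"])
    then show ?thesis using mem_pm_sums_iff S T h by simp
  qed
  then show "pm_sums G S = pm_sums G T"
    using pm_sums_closed[OF S] pm_sums_closed[OF T] by blast
next
  assume "set_mset S \<subseteq> carrier G \<and> set_mset T \<subseteq> carrier G \<and> pm_sums G S = pm_sums G T"
  then show "(S, T) \<in> H_equiv (seq_monoid G) (pm_zero_sum G)"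
    by (auto simp: H_equiv_def pm_zero_sum_iff pm_sums_union)
qed

lemma pm_class_eq_iff:
  assumes "set_mset S \<subseteq> carrier G" "set_mset T \<subseteq> carrier G"
  shows "pm_class G S = pm_class G T \<longleftrightarrow> pm_sums G S = pm_sums G T"
  unfolding H_class_def
  using assms equiv_H_equiv[of "seq_monoid G" "pm_zero_sum G"]
  by (simp add: eq_equiv_class_iff H_equiv_pm_zero_sum)

lemma pm_class_mult:
  assumes "set_mset S \<subseteq> carrier G" "set_mset T \<subseteq> carrier G"
  shows "pm_class G S \<otimes>\<^bsub>pm_class_semigroup G\<^esub> pm_class G T = pm_class G (S + T)"
  using comm_monoid.class_semigroup_mult[OF comm_monoid_seq_monoid, of S G T] assms by simp

end

lemma carrier_pm_class_semigroup:
  "carrier (pm_class_semigroup G) = {pm_class G S | S. set_mset S \<subseteq> carrier G}"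
  by (auto simp: class_semigroup_def H_class_def quotient_def)

lemma (in comm_monoid) comm_monoid_class_semigroup: "comm_monoid (class_semigroup H G)"
proof (rule comm_monoidI)
  have carrier: "x \<in> carrier (class_semigroup H G) \<longleftrightarrow> (\<exists>y \<in> carrier G. x = H_class G H y)" for x
    by (auto simp: class_semigroup_def H_class_def quotient_def)
  have one: "\<one>\<^bsub>class_semigroup H G\<^esub> = H_class G H \<one>"
    by (simp add: class_semigroup_def)
  note facts = carrier one class_semigroup_mult
  show "\<one>\<^bsub>class_semigroup H G\<^esub> \<in> carrier (class_semigroup H G)"
    by (auto simp: facts)
  fix x y z
  assume x: "x \<in> carrier (class_semigroup H G)" 
  then show "\<one>\<^bsub>class_semigroup H G\<^esub> \<otimes>\<^bsub>class_semigroup H G\<^esub> x = x"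
    by (auto simp: facts)
  assume y: "y \<in> carrier (class_semigroup H G)"
  show "x \<otimes>\<^bsub>class_semigroup H G\<^esub> y \<in> carrier (class_semigroup H G)"
    using x y by (auto simp: facts)
  show "x \<otimes>\<^bsub>class_semigroup H G\<^esub> y = y \<otimes>\<^bsub>class_semigroup H G\<^esub> x"
    using x y by (auto simp: facts m_comm)
  assume z: "z \<in> carrier (class_semigroup H G)"
  show "x \<otimes>\<^bsub>class_semigroup H G\<^esub> y \<otimes>\<^bsub>class_semigroup H G\<^esub> z
      = x \<otimes>\<^bsub>class_semigroup H G\<^esub> (y \<otimes>\<^bsub>class_semigroup H G\<^esub> z)"
    using x y z by (auto simp: facts m_assoc)
qed

section \<open>Clifford semigroups\<close>

context comm_monoid
begin

lemma comm_group_constituent: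
  assumes e: "e \<in> idempotents G"
  shows "comm_group (subsemigroup_at G (constituent G e) e)"
proof (rule comm_groupI)
  let ?C = "subsemigroup_at G (constituent G e) e"
  have e_carrier: "e \<in> carrier G" and ee: "e \<otimes> e = e"
    using e by (auto simp: idempotents_def)
  have memD: "x \<in> carrier G" "x \<otimes> e = x" "\<exists>y\<in>carrier G. x \<otimes> y = e" if "x \<in> carrier ?C" for x
    using that by (auto simp: subsemigroup_at_def constituent_def)
  show "\<one>\<^bsub>?C\<^esub> \<in> carrier ?C"
    using e_carrier ee by (auto simp: subsemigroup_at_def constituent_def)
  show "x \<otimes>\<^bsub>?C\<^esub> y \<otimes>\<^bsub>?C\<^esub> z = x \<otimes>\<^bsub>?C\<^esub> (y \<otimes>\<^bsub>?C\<^esub> z)"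
    if "x \<in> carrier ?C" "y \<in> carrier ?C" "z \<in> carrier ?C" for x y z
    using that[THEN memD(1)] by (simp add: subsemigroup_at_def m_assoc)
  show "x \<otimes>\<^bsub>?C\<^esub> y = y \<otimes>\<^bsub>?C\<^esub> x" if "x \<in> carrier ?C" "y \<in> carrier ?C" for x y
    using that[THEN memD(1)] by (simp add: subsemigroup_at_def m_comm)
  show "\<one>\<^bsub>?C\<^esub> \<otimes>\<^bsub>?C\<^esub> x = x" if "x \<in> carrier ?C" for x
    using memD[OF that] e_carrier by (simp add: subsemigroup_at_def m_comm)
  show "x \<otimes>\<^bsub>?C\<^esub> y \<in> carrier ?C" if x: "x \<in> carrier ?C" and y: "y \<in> carrier ?C" for x y
  proof -
    obtain x' y' where x': "x' \<in> carrier G" "x \<otimes> x' = e" and y': "y' \<in> carrier G" "y \<otimes> y' = e"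
      using memD(3)[OF x] memD(3)[OF y] by blast
    have carrier: "x \<in> carrier G" "y \<in> carrier G" using x y memD(1) by auto
    have "(x \<otimes> y) \<otimes> (x' \<otimes> y') = (x \<otimes> x') \<otimes> (y \<otimes> y')"
      using carrier x'(1) y'(1) by (simp add: m_ac)
    then have "(x \<otimes> y) \<otimes> (x' \<otimes> y') = e" using x' y' ee by simp
    moreover have "(x \<otimes> y) \<otimes> e = x \<otimes> y"
      using carrier e_carrier memD(2)[OF y] by (simp add: m_assoc)
    ultimately show ?thesis
      using carrier x'(1) y'(1) by (auto simp: subsemigroup_at_def constituent_def)
  qed
  show "\<exists>y\<in>carrier ?C. y \<otimes>\<^bsub>?C\<^esub> x = \<one>\<^bsub>?C\<^esub>" if x: "x \<in> carrier ?C" for x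
  proof -
    obtain y where y: "y \<in> carrier G" "x \<otimes> y = e" using memD(3)[OF x] by blast
    \<comment> \<open>the witness \<open>y\<close> need not be fixed by \<open>e\<close>, but \<open>y \<otimes> e\<close> is\<close>
    have "(y \<otimes> e) \<otimes> x = (x \<otimes> y) \<otimes> e"
      using y(1) e_carrier memD(1)[OF x] by (simp add: m_ac)
    then have "(y \<otimes> e) \<otimes> x = e"
      using y(2) ee by simp
    moreover have "(y \<otimes> e) \<otimes> e = y \<otimes> e" using y e_carrier ee by (simp add: m_assoc)
    ultimately show ?thesis
      using y(1) e_carrier memD(1)[OF x]
        \<open>x \<otimes> y = e\<close>
      by (intro bexI[of _ "y \<otimes> e"]) (auto simp: subsemigroup_at_def constituent_def)
  qed
qed

lemma constituent_eq_iff: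
  assumes e: "e \<in> idempotents G" and f: "f \<in> idempotents G"
  shows "constituent G e = constituent G f \<longleftrightarrow> e = f"
proof
  assume "constituent G e = constituent G f"
  moreover have "e \<in> constituent G e" "f \<in> constituent G f"
    using e f by (auto simp: idempotents_def constituent_def)
  ultimately have "e \<otimes> f = e" "f \<otimes> e = f" by (auto simp: constituent_def)
  moreover have "e \<otimes> f = f \<otimes> e" using e f by (simp add: idempotents_def m_comm)
  ultimately show "e = f" by simp
qed simp

lemma square_idempotent:
  assumes "x \<in> carrier G" "x \<otimes> x \<otimes> x = x"
  shows "x \<otimes> x \<in> idempotents G"
  using assms by (simp add: idempotents_def flip: m_assoc)

text \<open>If \<open>x\<^sup>3 = x\<close> holds throughout, every element is inverse to itself in its constituent
  group: if \<open>x e = x\<close> and \<open>x y = e\<close>, then \<open>x\<^sup>2 = x\<^sup>2 e = x\<^sup>3 y = x y = e\<close>.\<close>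

lemma constituent_eq_square_roots:
  assumes cube: "\<And>x. x \<in> carrier G \<Longrightarrow> x \<otimes> x \<otimes> x = x"
    and e: "e \<in> idempotents G"
  shows "constituent G e = {x \<in> carrier G. x \<otimes> x = e}"
proof (intro equalityI subsetI)
  have e_carrier: "e \<in> carrier G" using e by (simp add: idempotents_def)
  fix x assume "x \<in> constituent G e"
  then obtain y where x: "x \<in> carrier G" "x \<otimes> e = x" and y: "y \<in> carrier G" "x \<otimes> y = e"
    by (auto simp: constituent_def)
  have "x \<otimes> x = (x \<otimes> x) \<otimes> (x \<otimes> y)" using x e_carrier y(2) by (simp add: m_assoc)
  also have "\<dots> = (x \<otimes> x \<otimes> x) \<otimes> y" using x(1) y(1) by (simp add: m_assoc)
  also have "\<dots> = e" using cube[OF x(1)] y(2) by simp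
  finally show "x \<in> {x \<in> carrier G. x \<otimes> x = e}" using x by simp
next
  fix x assume "x \<in> {x \<in> carrier G. x \<otimes> x = e}"
  then show "x \<in> constituent G e"
    using cube[of x] by (auto simp: constituent_def m_assoc)
qed

lemma clifford_semigroup_if_cubes:
  assumes cube: "\<And>x. x \<in> carrier G \<Longrightarrow> x \<otimes> x \<otimes> x = x"
    and "finite (carrier G)"
  shows "clifford_semigroup G"
  unfolding clifford_semigroup_def
proof (intro conjI exI[of _ "constituent G ` idempotents G"] ballI)
  show "comm_monoid G" by (rule comm_monoid_axioms)
  show "finite (carrier G)" by fact
  show "\<exists>e. group (subsemigroup_at G A e)" if "A \<in> constituent G ` idempotents G" for A
    using that comm_group_constituent comm_group.axioms(2) by fast
  have "x \<in> constituent G (x \<otimes> x)" if "x \<in> carrier G" for x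
    using constituent_eq_square_roots[OF cube square_idempotent[OF that cube[OF that]]] that by simp
  then show "carrier G = \<Union> (constituent G ` idempotents G)"
    using square_idempotent cube by (fastforce simp: constituent_def)
qed

end

section \<open>Groups of exponent dividing four\<close>

lemma (in comm_group) lcos_mult_lcos:
  assumes "subgroup K G" "a \<in> carrier G" "b \<in> carrier G"
  shows "(a <# K) <#> (b <# K) = (a \<otimes> b) <# K"
proof -
  interpret K: normal K G
    using assms(1) by (simp add: subgroup_imp_normal)
  show ?thesis
    using assms K.coset_eq K.rcos_sum[of a b] by simp
qed

lemma (in group) set_mult_eq_left_iff:
  assumes H: "subgroup H G" and K: "subgroup K G"
  shows "H <#> K = H \<longleftrightarrow> K \<subseteq> H"
proof
  assume eq: "H <#> K = H"
  show "K \<subseteq> H"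
  proof
    fix x assume x: "x \<in> K"
    then have "\<one> \<otimes> x \<in> H <#> K"
      using subgroup.one_closed[OF H] unfolding set_mult_def by blast
    then show "x \<in> H" using eq subgroup.mem_carrier[OF K x] by simp
  qed
next
  assume le: "K \<subseteq> H"
  show "H <#> K = H"
  proof (intro equalityI subsetI)
    show "x \<in> H" if "x \<in> H <#> K" for x
      using that le subgroup.m_closed[OF H] unfolding set_mult_def by blast
    fix x assume x: "x \<in> H"
    then have "x \<otimes> \<one> \<in> H <#> K"
      using subgroup.one_closed[OF K] unfolding set_mult_def by blast
    then show "x \<in> H <#> K" using subgroup.mem_carrier[OF H x] by simp
  qed
qed

text \<open>An involution \<open>h\<close> contributes only the multiples \<open>0\<close> and \<open>h\<close>.\<close>

lemma (in comm_group) generate_insert_involution: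
  assumes X: "X \<subseteq> carrier G" and h: "h \<in> carrier G" "h \<otimes> h = \<one>"
  shows "generate G (insert h X) = generate G X \<union> (h <# generate G X)"
proof (rule generateI[symmetric])
  let ?K = "generate G X"
  interpret K: subgroup ?K G by (rule generate_is_subgroup[OF X])
  have inv_h: "inv h = h" using h by (simp add: inv_equality)
  have hh: "h \<otimes> (h \<otimes> k) = k" if "k \<in> carrier G" for k
    using h that by (simp flip: m_assoc)
  show "subgroup (?K \<union> (h <# ?K)) G"
  proof (rule subgroup.intro)
    show "?K \<union> (h <# ?K) \<subseteq> carrier G"
      using h K.subset by (auto simp: l_coset_def)
    show "x \<otimes> y \<in> ?K \<union> (h <# ?K)" if xy: "x \<in> ?K \<union> (h <# ?K)" "y \<in> ?K \<union> (h <# ?K)" for x y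
    proof -
      consider "x \<in> ?K" "y \<in> ?K" | k where "x = h \<otimes> k" "k \<in> ?K" "y \<in> ?K"
        | k where "y = h \<otimes> k" "k \<in> ?K" "x \<in> ?K"
        | k l where "x = h \<otimes> k" "y = h \<otimes> l" "k \<in> ?K" "l \<in> ?K"
        using xy unfolding l_coset_def by blast
      then show ?thesis
      proof cases
        case (2 k)
        then have "x \<otimes> y = h \<otimes> (k \<otimes> y)" using h by (simp add: m_assoc)
        then show ?thesis using 2 by (auto simp: l_coset_def)
      next
        case (3 k)
        then have "x \<otimes> y = h \<otimes> (x \<otimes> k)" using h by (simp add: m_lcomm)
        then show ?thesis using 3 by (auto simp: l_coset_def)
      next
        case (4 k l)
        then have "x \<otimes> y = h \<otimes> (h \<otimes> (k \<otimes> l))" using h by (simp add: m_ac)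
        then show ?thesis using 4 hh by simp
      qed simp
    qed
    show "\<one> \<in> ?K \<union> (h <# ?K)" by simp
    show "inv x \<in> ?K \<union> (h <# ?K)" if "x \<in> ?K \<union> (h <# ?K)" for x
      using that h inv_h by (auto simp: l_coset_def inv_mult)
  qed
  have "h \<otimes> \<one> \<in> h <# ?K" unfolding l_coset_def using K.one_closed by blast
  then show "insert h X \<subseteq> ?K \<union> (h <# ?K)"
    using h generate.incl[of _ X G] by auto
  show "?K \<union> (h <# ?K) \<subseteq> L" if L: "subgroup L G" "insert h X \<subseteq> L" for L
    using generate_subgroup_incl[of X L] L subgroup.m_closed[OF L(1)] by (auto simp: l_coset_def)
qed

definition double_span :: "('a, 'b) monoid_scheme \<Rightarrow> 'a multiset \<Rightarrow> 'a set" where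
  "double_span G S = generate G ((\<lambda>g. g \<otimes>\<^bsub>G\<^esub> g) ` set_mset S)"

text \<open>The condition is stated as \<open>2g + 2g = 0\<close> because it is used in the form that the doubles are
  involutions.\<close>

locale exponent_four_group = comm_group +
  assumes double_double: "g \<in> carrier G \<Longrightarrow> (g \<otimes> g) \<otimes> (g \<otimes> g) = \<one>"
begin

lemma subgroup_doubles: "subgroup (doubles G) G"
proof (rule subgroup.intro)
  show "x \<otimes> y \<in> doubles G" if xy: "x \<in> doubles G" "y \<in> doubles G" for x y
  proof -
    obtain g h where gh: "g \<in> carrier G" "h \<in> carrier G" and "x = g \<otimes> g" "y = h \<otimes> h"
      using xy by (auto simp: doubles_def)
    then have "x \<otimes> y = (g \<otimes> h) \<otimes> (g \<otimes> h)" by (simp add: m_ac)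
    then show ?thesis using gh unfolding doubles_def by blast
  qed
  have "\<one> = \<one> \<otimes> \<one>" by simp
  then show "\<one> \<in> doubles G" unfolding doubles_def by blast
  show "inv x \<in> doubles G" if "x \<in> doubles G" for x
    using that inv_mult unfolding doubles_def by blast
qed (auto simp: doubles_def)

lemma inv_eq_double_mult:
  assumes "g \<in> carrier G"
  shows "inv g = g \<otimes> (g \<otimes> g)"
proof -
  have "g \<otimes> (g \<otimes> g) \<otimes> g = \<one>"
    using double_double[OF assms] assms by (simp add: m_ac)
  then show ?thesis using assms by (simp add: inv_equality)
qed

lemma double_span_le_doubles:
  assumes "set_mset S \<subseteq> carrier G"
  shows "double_span G S \<subseteq> doubles G"
  unfolding double_span_def
  by (rule generate_subgroup_incl[OF _ subgroup_doubles]) (use assms in \<open>auto simp: doubles_def\<close>)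

lemma subgroup_double_span:
  assumes "set_mset S \<subseteq> carrier G"
  shows "subgroup (double_span G S) G"
  unfolding double_span_def
  by (rule generate_is_subgroup) (use assms in auto)

text \<open>Changing the sign of a term \<open>g\<close> changes a sum by \<open>2g\<close>, and the doubles are involutions,
  so the sums fill a coset of the span of the doubles. As representative one may take
  \<open>a = g\<^sub>1 + \<dots> + g\<^sub>\<ell>\<close>, whose double \<open>2g\<^sub>1 + \<dots> + 2g\<^sub>\<ell>\<close> lies in that span.\<close>

lemma pm_sums_eq_coset:
  assumes "set_mset S \<subseteq> carrier G"
  obtains a where "a \<in> carrier G" "a \<otimes> a \<in> double_span G S" "pm_sums G S = a <# double_span G S"
  using assms
proof (induction S arbitrary: thesis)
  case empty
  have "generate G {} = {\<one>}" by (rule generate_empty)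
  then show ?case using empty(1)[of \<one>] by (simp add: double_span_def pm_sums_empty l_coset_def)
next
  case (add g S)
  then have g: "g \<in> carrier G" and S: "set_mset S \<subseteq> carrier G" by auto
  let ?K = "double_span G S"
  interpret K: subgroup ?K G by (rule subgroup_double_span[OF S])
  obtain a where a: "a \<in> carrier G" "a \<otimes> a \<in> ?K" "pm_sums G S = a <# ?K"
    using add.IH S by blast
  have span: "double_span G (add_mset g S) = ?K \<union> ((g \<otimes> g) <# ?K)"
    unfolding double_span_def set_mset_add_mset_insert image_insert
    by (rule generate_insert_involution) (use S g double_double in auto)
  have "(g \<otimes> a) \<otimes> (g \<otimes> a) = (g \<otimes> g) \<otimes> (a \<otimes> a)"
    using g a(1) by (simp add: m_ac)
  then have "(g \<otimes> a) \<otimes> (g \<otimes> a) \<in> double_span G (add_mset g S)"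
    unfolding span l_coset_def using a(2) by blast
  moreover have "pm_sums G (add_mset g S) = (g \<otimes> a) <# double_span G (add_mset g S)"
  proof -
    have "pm_sums G (add_mset g S) = (g <# (a <# ?K)) \<union> (inv g <# (a <# ?K))"
      using pm_sums_add_mset[OF g S] a by simp
    also have "\<dots> = ((g \<otimes> a) <# ?K) \<union> ((inv g \<otimes> a) <# ?K)"
      using g a K.subset by (simp add: lcos_m_assoc)
    also have "inv g \<otimes> a = (g \<otimes> a) \<otimes> (g \<otimes> g)"
      using g a by (simp add: inv_eq_double_mult m_ac)
    also have "((g \<otimes> a) <# ?K) \<union> ((g \<otimes> a) \<otimes> (g \<otimes> g) <# ?K)
        = ((g \<otimes> a) <# ?K) \<union> ((g \<otimes> a) <# ((g \<otimes> g) <# ?K))"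
      using g a K.subset by (simp add: lcos_m_assoc)
    also have "\<dots> = (g \<otimes> a) <# double_span G (add_mset g S)"
      unfolding span l_coset_def by blast
    finally show ?thesis .
  qed
  ultimately show ?case by (rule add.prems(1)[OF m_closed[OF g a(1)]])
qed

text \<open>Twice the coset is the subgroup itself, because the double of its representative lies
  there.\<close>

lemma pm_sums_double:
  assumes S: "set_mset S \<subseteq> carrier G"
  shows "pm_sums G (S + S) = double_span G S"
proof -
  obtain a where a: "a \<in> carrier G" "a \<otimes> a \<in> double_span G S" "pm_sums G S = a <# double_span G S"
    by (rule pm_sums_eq_coset[OF S])
  have "pm_sums G (S + S) = (a <# double_span G S) <#> (a <# double_span G S)"
    unfolding pm_sums_union[OF S S] a(3) ..
  also have "\<dots> = (a \<otimes> a) <# double_span G S"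
    by (rule lcos_mult_lcos[OF subgroup_double_span[OF S] a(1) a(1)])
  also have "\<dots> = double_span G S"
    by (rule coset_join3) (use a subgroup_double_span[OF S] in auto)
  finally show ?thesis .
qed

lemma pm_sums_cube:
  assumes S: "set_mset S \<subseteq> carrier G"
  shows "pm_sums G (S + S + S) = pm_sums G S"
proof -
  obtain a where a: "a \<in> carrier G" "pm_sums G S = a <# double_span G S"
    by (rule pm_sums_eq_coset[OF S]) (rule that)
  have K: "subgroup (double_span G S) G" by (rule subgroup_double_span[OF S])
  have "pm_sums G (S + S + S) = (\<one> <# double_span G S) <#> (a <# double_span G S)"
    using S pm_sums_union[of "S + S" S]
    unfolding pm_sums_double[OF S] lcos_mult_one[OF subgroup.subset[OF K]] a(2) by simp
  also have "\<dots> = pm_sums G S"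
    unfolding lcos_mult_lcos[OF K one_closed a(1)] l_one[OF a(1)] a(2) ..
  finally show ?thesis .
qed

lemma pm_zero_sum_iff_eq_double_span:
  assumes S: "set_mset S \<subseteq> carrier G"
  shows "S \<in> pm_zero_sum G \<longleftrightarrow> pm_sums G S = double_span G S"
proof
  interpret K: subgroup "double_span G S" G by (rule subgroup_double_span[OF S])
  show "S \<in> pm_zero_sum G" if "pm_sums G S = double_span G S"
    using S that by (simp add: pm_zero_sum_iff)
  obtain a where a: "a \<in> carrier G" "pm_sums G S = a <# double_span G S"
    by (rule pm_sums_eq_coset[OF S]) (rule that)
  assume "S \<in> pm_zero_sum G"
  then have "\<one> \<in> a <# double_span G S" unfolding pm_zero_sum_iff a(2) by blast
  then have "a <# double_span G S = \<one> <# double_span G S"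
    by (rule l_repr_independence) (use a(1) K.is_subgroup in auto)
  then show "pm_sums G S = double_span G S"
    unfolding a(2) lcos_mult_one[OF K.subset] .
qed

lemma pm_zero_sum_iff_subgroup:
  assumes S: "set_mset S \<subseteq> carrier G"
  shows "S \<in> pm_zero_sum G \<longleftrightarrow> subgroup (pm_sums G S) (G\<lparr>carrier := doubles G\<rparr>)"
proof
  show "subgroup (pm_sums G S) (G\<lparr>carrier := doubles G\<rparr>)" if "S \<in> pm_zero_sum G"
    using that S subgroup_incl[OF subgroup_double_span[OF S] subgroup_doubles double_span_le_doubles[OF S]]
    by (simp add: pm_zero_sum_iff_eq_double_span)
  show "S \<in> pm_zero_sum G" if "subgroup (pm_sums G S) (G\<lparr>carrier := doubles G\<rparr>)"
    using S subgroup.one_closed[OF that] by (simp add: pm_zero_sum_iff)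
qed

lemma pm_class_idempotent_iff:
  assumes S: "set_mset S \<subseteq> carrier G"
  shows "pm_class G S \<in> idempotents (pm_class_semigroup G) \<longleftrightarrow> S \<in> pm_zero_sum G"
proof -
  have "pm_class G S \<in> carrier (pm_class_semigroup G)"
    unfolding carrier_pm_class_semigroup using S by blast
  then have "pm_class G S \<in> idempotents (pm_class_semigroup G) \<longleftrightarrow> pm_class G (S + S) = pm_class G S"
    using S by (simp add: idempotents_def pm_class_mult)
  also have "\<dots> \<longleftrightarrow> pm_sums G (S + S) = pm_sums G S"
    by (rule pm_class_eq_iff) (use S in auto)
  also have "\<dots> \<longleftrightarrow> S \<in> pm_zero_sum G"
    unfolding pm_sums_double[OF S] pm_zero_sum_iff_eq_double_span[OF S] by blast
  finally show ?thesis .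
qed

lemma idempotents_pm_class_semigroup:
  "idempotents (pm_class_semigroup G) = pm_class G ` pm_zero_sum G"
proof (intro equalityI subsetI)
  fix x assume x: "x \<in> idempotents (pm_class_semigroup G)"
  then obtain S where "set_mset S \<subseteq> carrier G" "x = pm_class G S"
    unfolding idempotents_def carrier_pm_class_semigroup by blast
  then show "x \<in> pm_class G ` pm_zero_sum G"
    using x pm_class_idempotent_iff by blast
next
  fix x assume "x \<in> pm_class G ` pm_zero_sum G"
  then show "x \<in> idempotents (pm_class_semigroup G)"
    using pm_class_idempotent_iff pm_zero_sum_iff by blast
qed

lemma pm_class_cube:
  assumes "x \<in> carrier (pm_class_semigroup G)"
  shows "x \<otimes>\<^bsub>pm_class_semigroup G\<^esub> x \<otimes>\<^bsub>pm_class_semigroup G\<^esub> x = x"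
proof -
  obtain S where S: "set_mset S \<subseteq> carrier G" and x: "x = pm_class G S"
    using assms unfolding carrier_pm_class_semigroup by blast
  have "pm_class G (S + S + S) = pm_class G S"
    using S by (subst pm_class_eq_iff) (simp_all add: pm_sums_cube)
  then show ?thesis unfolding x using S by (simp add: pm_class_mult)
qed

lemma subgroup_pm_sums:
  assumes "S \<in> pm_zero_sum G"
  shows "subgroup (pm_sums G S) G"
proof -
  have S: "set_mset S \<subseteq> carrier G" using assms by (simp add: pm_zero_sum_iff)
  then have "pm_sums G S = double_span G S"
    using assms pm_zero_sum_iff_eq_double_span by blast
  then show ?thesis using subgroup_double_span[OF S] by simp
qed

lemma rees_le_pm_class_iff:
  assumes S: "S \<in> pm_zero_sum G" and T: "T \<in> pm_zero_sum G"
  shows "rees_le (pm_class_semigroup G) (pm_class G S) (pm_class G T) \<longleftrightarrow> pm_sums G T \<subseteq> pm_sums G S"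
proof -
  have carrier: "set_mset S \<subseteq> carrier G" "set_mset T \<subseteq> carrier G"
    using S T by (auto simp: pm_zero_sum_iff)
  have "rees_le (pm_class_semigroup G) (pm_class G S) (pm_class G T)
      \<longleftrightarrow> pm_class G S \<otimes>\<^bsub>pm_class_semigroup G\<^esub> pm_class G T = pm_class G S"
    unfolding rees_le_def idempotents_pm_class_semigroup using S T by blast
  also have "\<dots> \<longleftrightarrow> pm_class G (S + T) = pm_class G S"
    unfolding pm_class_mult[OF carrier] ..
  also have "\<dots> \<longleftrightarrow> pm_sums G S <#> pm_sums G T = pm_sums G S"
    unfolding pm_sums_union[OF carrier, symmetric]
    by (rule pm_class_eq_iff) (use carrier in auto)
  also have "\<dots> \<longleftrightarrow> pm_sums G T \<subseteq> pm_sums G S"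
    using S T by (intro set_mult_eq_left_iff subgroup_pm_sums)
  finally show ?thesis .
qed

lemma comm_monoid_pm_class_semigroup: "comm_monoid (pm_class_semigroup G)"
  by (rule comm_monoid.comm_monoid_class_semigroup[OF comm_monoid_seq_monoid])

lemma constituent_pm_class_eq_iff:
  assumes S: "S \<in> pm_zero_sum G" and T: "T \<in> pm_zero_sum G"
  shows "constituent (pm_class_semigroup G) (pm_class G S) = constituent (pm_class_semigroup G) (pm_class G T)
    \<longleftrightarrow> pm_sums G S = pm_sums G T"
proof -
  have "constituent (pm_class_semigroup G) (pm_class G S) = constituent (pm_class_semigroup G) (pm_class G T)
      \<longleftrightarrow> pm_class G S = pm_class G T"
    by (rule comm_monoid.constituent_eq_iff[OF comm_monoid_pm_class_semigroup])
      (use S T idempotents_pm_class_semigroup in blast)+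
  then show ?thesis using S T by (simp add: pm_class_eq_iff pm_zero_sum_iff)
qed

lemma constituent_pm_class:
  assumes S0: "S0 \<in> pm_zero_sum G"
  shows "constituent (pm_class_semigroup G) (pm_class G S0)
    = {pm_class G S | S. set_mset S \<subseteq> carrier G \<and> double_span G S = pm_sums G S0}"
proof -
  have "pm_class G S0 \<in> idempotents (pm_class_semigroup G)"
    using S0 by (simp add: idempotents_pm_class_semigroup)
  then have "constituent (pm_class_semigroup G) (pm_class G S0) =
      {x \<in> carrier (pm_class_semigroup G). x \<otimes>\<^bsub>pm_class_semigroup G\<^esub> x = pm_class G S0}"
    by (intro comm_monoid.constituent_eq_square_roots[OF comm_monoid_pm_class_semigroup] pm_class_cube)
  also have "\<dots> = {pm_class G S | S. set_mset S \<subseteq> carrier G \<and>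
      pm_class G S \<otimes>\<^bsub>pm_class_semigroup G\<^esub> pm_class G S = pm_class G S0}"
    by (auto simp: carrier_pm_class_semigroup)
  also have "\<dots> = {pm_class G S | S. set_mset S \<subseteq> carrier G \<and> double_span G S = pm_sums G S0}"
    using S0 by (intro Collect_cong ex_cong1 conj_cong refl)
      (simp add: pm_class_mult pm_class_eq_iff pm_sums_double pm_zero_sum_iff)
  finally show ?thesis .
qed

text \<open>The semigroup is finite because a class is determined by a subset of the group.\<close>

lemma clifford_pm_class_semigroup:
  assumes "finite (carrier G)"
  shows "clifford_semigroup (pm_class_semigroup G)"
proof (rule comm_monoid.clifford_semigroup_if_cubes[OF comm_monoid_pm_class_semigroup pm_class_cube])
  let ?F = "{S. set_mset S \<subseteq> carrier G}"
  have "pm_class G S = pm_class G (inv_into ?F (pm_sums G) (pm_sums G S))" if "S \<in> ?F" for S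
  proof -
    have "pm_sums G S \<in> pm_sums G ` ?F" using that by blast
    from inv_into_into[OF this] f_inv_into_f[OF this] show ?thesis
      using that by (simp add: pm_class_eq_iff)
  qed
  then have "carrier (pm_class_semigroup G)
      \<subseteq> (\<lambda>A. pm_class G (inv_into ?F (pm_sums G) A)) ` pm_sums G ` ?F"
    unfolding carrier_pm_class_semigroup image_image by blast
  moreover have "pm_sums G ` ?F \<subseteq> Pow (carrier G)"
    using pm_sums_closed by blast
  then have "finite (pm_sums G ` ?F)"
    by (rule finite_subset) (use assms in simp)
  ultimately show "finite (carrier (pm_class_semigroup G))"
    by (meson finite_imageI finite_subset)
qed

end

section \<open>Elementary abelian 2-groups\<close>

text \<open>The isomorphism theorem in the form of a count; it computes the order of the constituent
  groups below.\<close>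

lemma (in group_hom) order_eq_card_times_kernel:
  assumes "h ` carrier G = carrier H"
  shows "order G = card (carrier H) * card (kernel G H h)"
proof -
  have "G Mod kernel G H h \<cong> H"
    using FactGroup_iso_set[OF assms] by (rule is_isoI)
  then have "card (rcosets\<^bsub>G\<^esub> (kernel G H h)) = card (carrier H)"
    using iso_same_card by (fastforce simp: FactGroup_def)
  then show ?thesis
    using G.lagrange[OF subgroup_kernel] by simp
qed

lemma carrier_cyclic_power:
  assumes "n > 0"
  shows "carrier (cyclic_power n r) = (\<Pi>\<^sub>E i\<in>{..<r}. {0..<int n})"
  using assms by (simp add: cyclic_power_def carrier_integer_mod_group)

lemma mult_cyclic_power:
  "x \<otimes>\<^bsub>cyclic_power n r\<^esub> y = (\<lambda>i\<in>{..<r}. (x i + y i) mod int n)"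
  by (simp add: cyclic_power_def)

lemma one_cyclic_power: "\<one>\<^bsub>cyclic_power n r\<^esub> = (\<lambda>i\<in>{..<r}. 0)"
  by (simp add: cyclic_power_def)

lemma group_cyclic_power: "group (cyclic_power n r)"
  by (simp add: cyclic_power_def)

lemma card_cyclic_power:
  assumes "n > 0"
  shows "card (carrier (cyclic_power n r)) = n ^ r"
  using assms by (simp add: carrier_cyclic_power card_PiE)

text \<open>As long as the image of an embedding is too small to be the whole group, any element \<open>a\<close>
  outside of it gives one more independent direction.\<close>

lemma (in comm_group) ex_embedding_cyclic_power_2:
  assumes inv: "\<And>x. x \<in> carrier G \<Longrightarrow> x \<otimes> x = \<one>"
    and card: "card (carrier G) = 2 ^ n" and "k \<le> n"
  shows "\<exists>h \<in> hom (cyclic_power 2 k) G. inj_on h (carrier (cyclic_power 2 k))"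
  using \<open>k \<le> n\<close>
proof (induction k)
  case 0
  have "(\<lambda>_. \<one>) \<in> hom (cyclic_power 2 0) G" by (simp add: hom_def)
  moreover have "inj_on (\<lambda>_. \<one>) (carrier (cyclic_power 2 0))"
    by (simp add: carrier_cyclic_power)
  ultimately show ?case by blast
next
  case (Suc k)
  let ?C = "cyclic_power 2 k" and ?C' = "cyclic_power 2 (Suc k)"
  obtain h where h: "h \<in> hom ?C G" "inj_on h (carrier ?C)"
    using Suc by auto
  interpret h: group_hom ?C G h
    using h(1) group_cyclic_power by (simp add: group_hom_def group_hom_axioms_def)
  have "card (h ` carrier ?C) < card (carrier G)"
    using h(2) Suc.prems card by (simp add: card_image card_cyclic_power)
  then have "\<not> carrier G \<subseteq> h ` carrier ?C"
    using h.hom_closed by (metis image_subsetI less_irrefl subset_antisym)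
  then obtain a where a: "a \<in> carrier G" "a \<notin> h ` carrier ?C" by blast
  define h' where "h' x = h (restrict x {..<k}) \<otimes> a [^] x k" for x :: "nat \<Rightarrow> int"
  have restr: "restrict x {..<k} \<in> carrier ?C" if "x \<in> carrier ?C'" for x
    using that by (auto simp: carrier_cyclic_power PiE_iff)
  have last: "x k = 0 \<or> x k = 1" if "x \<in> carrier ?C'" for x
    using that by (force simp: carrier_cyclic_power PiE_iff)
  have hom: "h' \<in> hom ?C' G"
  proof (rule homI)
    fix x y assume x: "x \<in> carrier ?C'" and y: "y \<in> carrier ?C'"
    show "h' x \<in> carrier G"
      using a restr[OF x] by (simp add: h'_def)
    have "restrict (x \<otimes>\<^bsub>?C'\<^esub> y) {..<k} = restrict x {..<k} \<otimes>\<^bsub>?C\<^esub> restrict y {..<k}"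
      by (auto simp: mult_cyclic_power fun_eq_iff)
    then have "h (restrict (x \<otimes>\<^bsub>?C'\<^esub> y) {..<k}) = h (restrict x {..<k}) \<otimes> h (restrict y {..<k})"
      using restr[OF x] restr[OF y] by simp
    moreover have "a [^] ((x \<otimes>\<^bsub>?C'\<^esub> y) k) = a [^] x k \<otimes> a [^] y k"
      using last[OF x] last[OF y] a(1) inv[OF a(1)] by (auto simp: mult_cyclic_power)
    ultimately show "h' (x \<otimes>\<^bsub>?C'\<^esub> y) = h' x \<otimes> h' y"
      using a(1) restr[OF x] restr[OF y] by (simp add: h'_def m_ac)
  qed
  interpret h': group_hom ?C' G h'
    using hom group_cyclic_power by (simp add: group_hom_def group_hom_axioms_def)
  have "x = \<one>\<^bsub>?C'\<^esub>" if x: "x \<in> carrier ?C'" and eq: "h' x = \<one>" for x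
    using last[OF x]
  proof
    assume x0: "x k = 0"
    have "h (restrict x {..<k}) = \<one>"
      using eq x0 a(1) restr[OF x] by (simp add: h'_def)
    then have "restrict x {..<k} = \<one>\<^bsub>?C\<^esub>"
      using h(2) restr[OF x] h.inj_on_one_iff by blast
    then have "x i = \<one>\<^bsub>?C\<^esub> i" if "i < k" for i
      using that by (metis lessThan_iff restrict_apply')
    then show ?thesis
      using x x0 by (intro PiE_ext[of _ "{..<Suc k}" "\<lambda>_. {0..<2}"])
        (auto simp: carrier_cyclic_power one_cyclic_power less_Suc_eq)
  next
    \<comment> \<open>impossible: \<open>a\<close> would lie in the image of \<open>h\<close>\<close>
    assume x1: "x k = 1"
    have "h (restrict x {..<k}) \<otimes> a = \<one>"
      using eq x1 a(1) restr[OF x] by (simp add: h'_def)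
    then have "a = inv h (restrict x {..<k})"
      using a(1) restr[OF x] by (metis h.hom_closed inv_equality inv_inv)
    also have "\<dots> = h (inv\<^bsub>?C\<^esub> restrict x {..<k})"
      using restr[OF x] by simp
    also have "\<dots> \<in> h ` carrier ?C"
      using restr[OF x] by blast
    finally show ?thesis using a(2) by blast
  qed
  then have "inj_on h' (carrier ?C')"
    unfolding h'.inj_on_one_iff by blast
  then show ?case using hom by blast
qed

lemma (in comm_group) iso_cyclic_power_2:
  assumes inv: "\<And>x. x \<in> carrier G \<Longrightarrow> x \<otimes> x = \<one>"
    and card: "card (carrier G) = 2 ^ n"
  shows "G \<cong> cyclic_power 2 n"
proof -
  obtain h where h: "h \<in> hom (cyclic_power 2 n) G" "inj_on h (carrier (cyclic_power 2 n))"
    using ex_embedding_cyclic_power_2[OF inv card order_refl] by blast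
  have "finite (carrier G)"
    using card by (intro card_ge_0_finite) simp
  moreover have "h ` carrier (cyclic_power 2 n) \<subseteq> carrier G"
    using h(1) by (auto simp: hom_def)
  moreover have "card (h ` carrier (cyclic_power 2 n)) = card (carrier G)"
    using h(2) card by (simp add: card_image card_cyclic_power)
  ultimately have "h ` carrier (cyclic_power 2 n) = carrier G"
    by (rule card_subset_eq)
  then have "cyclic_power 2 n \<cong> G"
    using h by (intro is_isoI) (simp add: iso_iff)
  then show ?thesis
    by (rule group.iso_sym[OF group_cyclic_power])
qed

lemma cyclic_power_2_double:
  assumes "x \<in> carrier (cyclic_power 2 r)"
  shows "x \<otimes>\<^bsub>cyclic_power 2 r\<^esub> x = \<one>\<^bsub>cyclic_power 2 r\<^esub>"
  by (auto simp: mult_cyclic_power one_cyclic_power fun_eq_iff)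

lemma cyclic_power_4_double_eq_one_iff:
  assumes "x \<in> carrier (cyclic_power 4 t)"
  shows "x \<otimes>\<^bsub>cyclic_power 4 t\<^esub> x = \<one>\<^bsub>cyclic_power 4 t\<^esub>
    \<longleftrightarrow> x \<in> (\<Pi>\<^sub>E i\<in>{..<t}. {0, 2})"
proof -
  have "(x i + x i) mod 4 = 0 \<longleftrightarrow> x i \<in> {0, 2}" if "i < t" for i
  proof -
    have "0 \<le> x i" "x i < 4"
      using assms that by (auto simp: carrier_cyclic_power PiE_iff)
    then have "x i \<in> {0, 1, 2, 3}" by auto
    then show ?thesis by auto
  qed
  then show ?thesis
    using assms by (auto simp: mult_cyclic_power one_cyclic_power fun_eq_iff carrier_cyclic_power PiE_iff)
qed

text \<open>Doubling kills \<open>C\<^sub>2\<^sup>r\<close> and, in each factor \<open>C\<^sub>4\<close>, exactly \<open>0\<close> and \<open>2\<close>.\<close>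

lemma iso_two_four_structure:
  fixes G :: "('a, 'b) monoid_scheme" (structure)
  assumes G: "comm_group G" and iso: "G \<cong> cyclic_power 2 r \<times>\<times> cyclic_power 4 t"
  shows "finite (carrier G)"
    and "exponent_four_group G"
    and "card {g \<in> carrier G. g \<otimes> g = \<one>} = 2 ^ (r + t)"
proof -
  interpret comm_group G by (rule G)
  let ?A = "cyclic_power 2 r" and ?B = "cyclic_power 4 t"
  let ?T = "\<Pi>\<^sub>E i\<in>{..<t}. {0 :: int, 2}"
  obtain h where h: "h \<in> iso G (?A \<times>\<times> ?B)" using iso by (auto simp: is_iso_def)
  interpret h: group_hom G "?A \<times>\<times> ?B" h
    using h by (auto simp: group_hom_def group_hom_axioms_def iso_def intro!: DirProd_group group_cyclic_power)
  have inj: "inj_on h (carrier G)" and img: "h ` carrier G = carrier ?A \<times> carrier ?B"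
    using h by (auto simp: iso_iff)
  have "finite (h ` carrier G)"
    unfolding img by (simp add: carrier_cyclic_power finite_PiE)
  then show fin: "finite (carrier G)"
    using inj finite_imageD by blast
  have one_iff: "g = \<one> \<longleftrightarrow> h g = \<one>\<^bsub>?A \<times>\<times> ?B\<^esub>" if "g \<in> carrier G" for g
    using inj_on_eq_iff[OF inj that one_closed] by simp
  have "(g \<otimes> g) \<otimes> (g \<otimes> g) = \<one>" if g: "g \<in> carrier G" for g
  proof -
    obtain x y where xy: "h g = (x, y)" by fastforce
    then have "h ((g \<otimes> g) \<otimes> (g \<otimes> g)) = \<one>\<^bsub>?A \<times>\<times> ?B\<^esub>"
      using g by (auto simp: mult_cyclic_power one_cyclic_power fun_eq_iff) presburger+
    then show ?thesis using one_iff g by simp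
  qed
  then show "exponent_four_group G"
    by unfold_locales
  have double_iff: "g \<otimes> g = \<one> \<longleftrightarrow> h g \<in> carrier ?A \<times> ?T"
    if g: "g \<in> carrier G" for g
  proof -
    obtain x y where xy: "h g = (x, y)" by fastforce
    then have "x \<in> carrier ?A" "y \<in> carrier ?B" using h.hom_closed[OF g] by auto
    moreover have "g \<otimes> g = \<one> \<longleftrightarrow> h g \<otimes>\<^bsub>?A \<times>\<times> ?B\<^esub> h g = \<one>\<^bsub>?A \<times>\<times> ?B\<^esub>"
      using one_iff[of "g \<otimes> g"] g by simp
    ultimately show ?thesis
      using cyclic_power_2_double cyclic_power_4_double_eq_one_iff xy by simp
  qed
  have sub: "?T \<subseteq> carrier ?B"
    by (auto simp: carrier_cyclic_power intro!: PiE_mono)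
  have img_torsion: "h ` {g \<in> carrier G. g \<otimes> g = \<one>} = carrier ?A \<times> ?T"
  proof (intro equalityI subsetI)
    fix p assume p: "p \<in> carrier ?A \<times> ?T"
    then have "p \<in> h ` carrier G" unfolding img using sub by blast
    then obtain g where g: "g \<in> carrier G" "p = h g" by blast
    then have "g \<otimes> g = \<one>" using double_iff[OF g(1)] p by (simp only:)
    then show "p \<in> h ` {g \<in> carrier G. g \<otimes> g = \<one>}" using g by blast
  next
    fix p assume "p \<in> h ` {g \<in> carrier G. g \<otimes> g = \<one>}"
    then obtain g where g: "g \<in> carrier G" "g \<otimes> g = \<one>" "p = h g" by blast
    then show "p \<in> carrier ?A \<times> ?T" using double_iff[OF g(1)] by (simp only:)
  qed
  have "inj_on h {g \<in> carrier G. g \<otimes> g = \<one>}"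
    using inj by (rule inj_on_subset) blast
  note card_image[OF this, unfolded img_torsion]
  then show "card {g \<in> carrier G. g \<otimes> g = \<one>} = 2 ^ (r + t)"
    by (simp add: card_cartesian_product card_cyclic_power card_PiE power_add flip: numeral_2_eq_2)
qed

section \<open>The constituent groups\<close>

context exponent_four_group
begin

lemma subgroup_halves:
  assumes "subgroup K G"
  shows "subgroup {g \<in> carrier G. g \<otimes> g \<in> K} G"
proof (rule subgroup.intro)
  show "x \<otimes> y \<in> {g \<in> carrier G. g \<otimes> g \<in> K}"
    if xy: "x \<in> {g \<in> carrier G. g \<otimes> g \<in> K}" "y \<in> {g \<in> carrier G. g \<otimes> g \<in> K}" for x y
  proof -
    have "(x \<otimes> y) \<otimes> (x \<otimes> y) = (x \<otimes> x) \<otimes> (y \<otimes> y)" using xy by (simp add: m_ac)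
    then show ?thesis using xy subgroup.m_closed[OF assms] by simp
  qed
  show "inv x \<in> {g \<in> carrier G. g \<otimes> g \<in> K}" if x: "x \<in> {g \<in> carrier G. g \<otimes> g \<in> K}" for x
    using x subgroup.m_inv_closed[OF assms, of "x \<otimes> x"] by (simp add: inv_mult)
qed (use subgroup.one_closed[OF assms] in auto)

text \<open>Doubling maps the group of halves of \<open>K\<close> onto \<open>K\<close>; its kernel is the 2-torsion of \<open>G\<close>.\<close>

lemma card_halves:
  assumes K: "subgroup K G" "K \<subseteq> doubles G"
  shows "card {g \<in> carrier G. g \<otimes> g \<in> K} = card K * card {g \<in> carrier G. g \<otimes> g = \<one>}"
proof -
  let ?A = "{g \<in> carrier G. g \<otimes> g \<in> K}"
  have A: "subgroup ?A G" by (rule subgroup_halves[OF K(1)])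
  interpret d: group_hom "G\<lparr>carrier := ?A\<rparr>" "G\<lparr>carrier := K\<rparr>" "\<lambda>g. g \<otimes> g"
  proof (intro group_hom.intro group_hom_axioms.intro)
    show "group (G\<lparr>carrier := ?A\<rparr>)" "group (G\<lparr>carrier := K\<rparr>)"
      using A K(1) by (auto intro: subgroup_imp_group)
    show "(\<lambda>g. g \<otimes> g) \<in> hom (G\<lparr>carrier := ?A\<rparr>) (G\<lparr>carrier := K\<rparr>)"
      by (rule homI) (auto simp: m_ac)
  qed
  have "(\<lambda>g. g \<otimes> g) ` ?A = K"
    using K(2) by (auto simp: doubles_def)
  then have "card ?A = card K * card (kernel (G\<lparr>carrier := ?A\<rparr>) (G\<lparr>carrier := K\<rparr>) (\<lambda>g. g \<otimes> g))"
    using d.order_eq_card_times_kernel by (simp add: order_def)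
  also have "kernel (G\<lparr>carrier := ?A\<rparr>) (G\<lparr>carrier := K\<rparr>) (\<lambda>g. g \<otimes> g) = {g \<in> carrier G. g \<otimes> g = \<one>}"
    using subgroup.one_closed[OF K(1)] by (auto simp: kernel_def)
  finally show ?thesis .
qed

context
  fixes S0 K
  assumes S0: "S0 \<in> pm_zero_sum G" and K: "pm_sums G S0 = K"
begin

lemma zero_sum_carrier: "set_mset S0 \<subseteq> carrier G"
  using S0 by (simp add: pm_zero_sum_iff)

lemma zero_sum_subgroup: "subgroup K G"
  using subgroup_pm_sums[OF S0] K by simp

lemma zero_sum_double_span: "double_span G S0 = K"
  using S0 K pm_zero_sum_iff_eq_double_span[OF zero_sum_carrier] by blast

text \<open>The two signs of \<open>g\<close> give the same coset when \<open>2g\<close> lies in \<open>K\<close>.\<close>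

lemma pm_sums_add_half:
  assumes g: "g \<in> carrier G" "g \<otimes> g \<in> K"
  shows "pm_sums G (add_mset g S0) = g <# K"
proof -
  have "inv g \<in> g <# K"
    unfolding l_coset_def inv_eq_double_mult[OF g(1)] using g(2) by blast
  then have "g <# K = inv g <# K"
    by (rule l_repr_independence) (use g zero_sum_subgroup in auto)
  then show ?thesis
    using pm_sums_add_mset[OF g(1) zero_sum_carrier] K by simp
qed

text \<open>The constituent group at \<open>S\<^sub>0\<close> consists of the classes \<open>[S]\<close> for which \<open>K\<close> is the span
  of the doubles. The sums of such an \<open>S\<close> form a coset \<open>a + K\<close> with \<open>2a \<in> K\<close>, and so do those of
  \<open>S\<^sub>0\<close> with the one term \<open>a\<close> added.\<close>

lemma constituent_eq_image_halves:
  "constituent (pm_class_semigroup G) (pm_class G S0)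
    = (\<lambda>g. pm_class G (add_mset g S0)) ` {g \<in> carrier G. g \<otimes> g \<in> K}"
proof (intro equalityI subsetI)
  fix x assume "x \<in> constituent (pm_class_semigroup G) (pm_class G S0)"
  then obtain S where S: "set_mset S \<subseteq> carrier G" and span: "double_span G S = K"
    and x: "x = pm_class G S"
    unfolding constituent_pm_class[OF S0] K by blast
  obtain a where a: "a \<in> carrier G" "a \<otimes> a \<in> double_span G S" "pm_sums G S = a <# double_span G S"
    by (rule pm_sums_eq_coset[OF S])
  have "pm_sums G S = pm_sums G (add_mset a S0)"
    using pm_sums_add_half a unfolding span by simp
  then have "x = pm_class G (add_mset a S0)"
    unfolding x by (subst pm_class_eq_iff) (use S zero_sum_carrier a in auto)
  then show "x \<in> (\<lambda>g. pm_class G (add_mset g S0)) ` {g \<in> carrier G. g \<otimes> g \<in> K}"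
    using a unfolding span by blast
next
  fix x assume "x \<in> (\<lambda>g. pm_class G (add_mset g S0)) ` {g \<in> carrier G. g \<otimes> g \<in> K}"
  then obtain g where g: "g \<in> carrier G" "g \<otimes> g \<in> K" and x: "x = pm_class G (add_mset g S0)"
    by blast
  have carrier: "set_mset (add_mset g S0) \<subseteq> carrier G" using g zero_sum_carrier by simp
  have "double_span G (add_mset g S0) = (g <# K) <#> (g <# K)"
    unfolding pm_sums_double[OF carrier, symmetric] pm_sums_union[OF carrier carrier] pm_sums_add_half[OF g] ..
  also have "\<dots> = (g \<otimes> g) <# K" by (rule lcos_mult_lcos[OF zero_sum_subgroup g(1) g(1)])
  also have "\<dots> = K" by (rule coset_join3) (use g zero_sum_subgroup in auto)
  finally show "x \<in> constituent (pm_class_semigroup G) (pm_class G S0)"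
    unfolding constituent_pm_class[OF S0] K x using carrier by blast
qed

lemma constituent_eq_coset:
  "constituent (pm_class_semigroup G) (pm_class G S0)
    = pm_class G S0 <#\<^bsub>pm_class_semigroup G\<^esub> {pm_class G {#g#} | g. g \<in> carrier G \<and> g \<otimes> g \<in> K}"
proof -
  have "pm_class G S0 <#\<^bsub>pm_class_semigroup G\<^esub> {pm_class G {#g#} | g. g \<in> carrier G \<and> g \<otimes> g \<in> K}
      = (\<lambda>g. pm_class G S0 \<otimes>\<^bsub>pm_class_semigroup G\<^esub> pm_class G {#g#}) ` {g \<in> carrier G. g \<otimes> g \<in> K}"
    unfolding l_coset_def by blast
  also have "\<dots> = (\<lambda>g. pm_class G (add_mset g S0)) ` {g \<in> carrier G. g \<otimes> g \<in> K}"
    using zero_sum_carrier by (intro image_cong refl) (simp add: pm_class_mult)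
  finally show ?thesis
    unfolding constituent_eq_image_halves ..
qed

text \<open>By the previous lemmas \<open>g \<mapsto> [S\<^sub>0] + [g]\<close> identifies the constituent group with the group
  of halves of \<open>K\<close> modulo \<open>K\<close>. Counting the halves by \<open>card_halves\<close> shows that this quotient has
  as many elements as the 2-torsion of \<open>G\<close>; since each of its elements squares to the identity,
  its order determines it.\<close>

lemma constituent_iso:
  assumes fin: "finite (carrier G)" and card: "card {g \<in> carrier G. g \<otimes> g = \<one>} = 2 ^ n"
  shows "subsemigroup_at (pm_class_semigroup G)
      (constituent (pm_class_semigroup G) (pm_class G S0)) (pm_class G S0) \<cong> cyclic_power 2 n"
proof -
  let ?C = "pm_class_semigroup G"
  let ?D = "subsemigroup_at ?C (constituent ?C (pm_class G S0)) (pm_class G S0)"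
  let ?A = "{g \<in> carrier G. g \<otimes> g \<in> K}"
  let ?f = "\<lambda>g. pm_class G (add_mset g S0)"
  have idem: "pm_class G S0 \<in> idempotents ?C"
    using S0 by (simp add: idempotents_pm_class_semigroup)
  interpret D: comm_group ?D
    by (rule comm_monoid.comm_group_constituent[OF comm_monoid_pm_class_semigroup idem])
  have carrier_D: "carrier ?D = ?f ` ?A"
    by (simp add: subsemigroup_at_def constituent_eq_image_halves)
  have mult_D: "x \<otimes>\<^bsub>?D\<^esub> y = x \<otimes>\<^bsub>?C\<^esub> y" for x y
    by (simp add: subsemigroup_at_def)
  have one_D: "\<one>\<^bsub>?D\<^esub> = pm_class G S0"
    by (simp add: subsemigroup_at_def)
  have A: "subgroup ?A G" by (rule subgroup_halves[OF zero_sum_subgroup])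
  interpret f: group_hom "G\<lparr>carrier := ?A\<rparr>" ?D ?f
  proof (intro group_hom.intro group_hom_axioms.intro homI)
    show "group (G\<lparr>carrier := ?A\<rparr>)" using A by (rule subgroup_imp_group)
    show "group ?D" by (rule D.is_group)
    fix x assume x: "x \<in> carrier (G\<lparr>carrier := ?A\<rparr>)"
    then show "?f x \<in> carrier ?D" unfolding carrier_D by simp
    fix y assume y: "y \<in> carrier (G\<lparr>carrier := ?A\<rparr>)"
    have xA: "x \<in> carrier G" "x \<otimes> x \<in> K" and yA: "y \<in> carrier G" "y \<otimes> y \<in> K" using x y by auto
    have carrier: "set_mset (add_mset x S0) \<subseteq> carrier G" "set_mset (add_mset y S0) \<subseteq> carrier G"
      using xA yA zero_sum_carrier by auto
    have "x \<otimes> y \<in> ?A" using subgroup.m_closed[OF A] x y by simp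
    then have "pm_sums G (add_mset (x \<otimes> y) S0) = pm_sums G (add_mset x S0 + add_mset y S0)"
      unfolding pm_sums_union[OF carrier] pm_sums_add_half[OF xA] pm_sums_add_half[OF yA]
        lcos_mult_lcos[OF zero_sum_subgroup xA(1) yA(1)]
      using pm_sums_add_half by blast
    then have "?f (x \<otimes> y) = pm_class G (add_mset x S0 + add_mset y S0)"
      by (subst pm_class_eq_iff) (use carrier xA yA in auto)
    then show "?f (x \<otimes>\<^bsub>G\<lparr>carrier := ?A\<rparr>\<^esub> y) = ?f x \<otimes>\<^bsub>?D\<^esub> ?f y"
      unfolding mult_D pm_class_mult[OF carrier] by simp
  qed
  have "kernel (G\<lparr>carrier := ?A\<rparr>) ?D ?f = {g \<in> ?A. g <# K = K}"
  proof -
    have "?f g = pm_class G S0 \<longleftrightarrow> g <# K = K" if "g \<in> ?A" for g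
      using that zero_sum_carrier pm_sums_add_half K by (subst pm_class_eq_iff) auto
    then show ?thesis unfolding kernel_def one_D by auto
  qed
  also have "\<dots> = K"
  proof (intro equalityI subsetI)
    fix g assume g: "g \<in> {g \<in> ?A. g <# K = K}"
    have "g \<otimes> \<one> \<in> g <# K"
      unfolding l_coset_def using subgroup.one_closed[OF zero_sum_subgroup] by blast
    then show "g \<in> K" using g by simp
  next
    fix g assume g: "g \<in> K"
    then have "g \<in> carrier G" using subgroup.mem_carrier[OF zero_sum_subgroup] by blast
    then show "g \<in> {g \<in> ?A. g <# K = K}"
      using coset_join3[OF _ zero_sum_subgroup g] subgroup.m_closed[OF zero_sum_subgroup g g] by simp
  qed
  finally have kernel: "kernel (G\<lparr>carrier := ?A\<rparr>) ?D ?f = K" .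
  have "card ?A = card (carrier ?D) * card K"
    using f.order_eq_card_times_kernel carrier_D kernel by (simp add: order_def)
  moreover have "card ?A = card K * 2 ^ n"
    using card_halves[OF zero_sum_subgroup] double_span_le_doubles[OF zero_sum_carrier] zero_sum_double_span card by simp
  moreover have "card K > 0"
    using subgroup.finite_imp_card_positive[OF zero_sum_subgroup fin] .
  ultimately have card_D: "card (carrier ?D) = 2 ^ n" by simp
  have "x \<otimes>\<^bsub>?D\<^esub> x = \<one>\<^bsub>?D\<^esub>" if "x \<in> carrier ?D" for x
  proof -
    have "x \<in> constituent ?C (pm_class G S0)" using that by (simp add: subsemigroup_at_def)
    then have "x \<otimes>\<^bsub>?C\<^esub> x = pm_class G S0"
      using comm_monoid.constituent_eq_square_roots[OF comm_monoid_pm_class_semigroup pm_class_cube idem]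
      by blast
    then show ?thesis unfolding mult_D one_D .
  qed
  then show ?thesis using card_D by (rule D.iso_cyclic_power_2)
qed

end

text \<open>Repeating a term contributes its double to the span and, with opposite signs, \<open>0\<close> to the
  sums; so the sums of \<open>g\<^sub>1\<^sup>2 \<cdots> g\<^sub>s\<^sup>2\<close> fill the span of \<open>2g\<^sub>1, \<dots>, 2g\<^sub>s\<close>.\<close>

lemma pm_sums_squares_of_generators:
  assumes G1: "subgroup G1 (G\<lparr>carrier := doubles G\<rparr>)"
    and gs: "set gs \<subseteq> carrier G"
    and gen: "generate (G\<lparr>carrier := G1\<rparr>) ((\<lambda>g. g \<otimes> g) ` set gs) = G1"
  shows "(\<Sum>g\<leftarrow>gs. replicate_mset 2 g) \<in> pm_zero_sum G"
    and "pm_sums G (\<Sum>g\<leftarrow>gs. replicate_mset 2 g) = G1"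
proof -
  have G1': "subgroup G1 G" by (rule incl_subgroup[OF subgroup_doubles G1])
  have sub: "(\<lambda>g. g \<otimes> g) ` set gs \<subseteq> G1"
  proof
    fix x assume "x \<in> (\<lambda>g. g \<otimes> g) ` set gs"
    then have "x \<in> generate (G\<lparr>carrier := G1\<rparr>) ((\<lambda>g. g \<otimes> g) ` set gs)" by (rule generate.incl)
    then show "x \<in> G1" unfolding gen .
  qed
  have eq: "(\<Sum>g\<leftarrow>gs. replicate_mset 2 g) = mset gs + mset gs"
    by (induction gs) (simp_all add: numeral_2_eq_2)
  have "double_span G (mset gs) = G1"
    using gen generate_consistent[OF sub G1'] by (simp add: double_span_def)
  then show sums: "pm_sums G (\<Sum>g\<leftarrow>gs. replicate_mset 2 g) = G1"
    unfolding eq using gs by (simp add: pm_sums_double)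
  show "(\<Sum>g\<leftarrow>gs. replicate_mset 2 g) \<in> pm_zero_sum G"
    unfolding pm_zero_sum_iff sums using subgroup.one_closed[OF G1'] gs by (simp add: eq)
qed

end

section \<open>The class semigroup of \<open>C\<^sub>2\<^sup>r \<oplus> C\<^sub>4\<^sup>t\<close>\<close>

theorem theorem5p5:
  fixes G :: "('a, 'b) monoid_scheme" and r t :: nat
  assumes "comm_group G"
    and "t \<ge> 1"
    and "G \<cong> cyclic_power 2 r \<times>\<times> cyclic_power 4 t"
  shows
    "(\<forall>S \<in> carrier (seq_monoid G).
        (pm_class G S \<in> idempotents (pm_class_semigroup G) \<longleftrightarrow> S \<in> pm_zero_sum G) \<and>
        (S \<in> pm_zero_sum G \<longleftrightarrow> subgroup (pm_sums G S) (G\<lparr>carrier := doubles G\<rparr>))) \<and>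
     (\<forall>S1 \<in> pm_zero_sum G. \<forall>S2 \<in> pm_zero_sum G.
        (rees_le (pm_class_semigroup G) (pm_class G S1) (pm_class G S2)
           \<longleftrightarrow> pm_sums G S1 \<supseteq> pm_sums G S2) \<and>
        (constituent (pm_class_semigroup G) (pm_class G S1)
             = constituent (pm_class_semigroup G) (pm_class G S2)
           \<longleftrightarrow> pm_sums G S1 = pm_sums G S2)) \<and>
     (clifford_semigroup (pm_class_semigroup G) \<and>
      {constituent (pm_class_semigroup G) (pm_class G S) | S. S \<in> pm_zero_sum G}
        = {constituent (pm_class_semigroup G) e | e. e \<in> idempotents (pm_class_semigroup G)}) \<and>
     (\<forall>G1 gs S0.
        subgroup G1 (G\<lparr>carrier := doubles G\<rparr>) \<and>
        set gs \<subseteq> carrier G \<and>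
        is_basis (G\<lparr>carrier := G1\<rparr>) (map (\<lambda>g. g \<otimes>\<^bsub>G\<^esub> g) gs) \<and>
        S0 = (\<Sum>g\<leftarrow>gs. replicate_mset 2 g) \<longrightarrow>
          S0 \<in> pm_zero_sum G \<and>
          pm_sums G S0 = G1 \<and>
          constituent (pm_class_semigroup G) (pm_class G S0)
            = pm_class G S0 <#\<^bsub>pm_class_semigroup G\<^esub>
                {pm_class G {#g#} | g. g \<in> carrier G \<and> g \<otimes>\<^bsub>G\<^esub> g \<in> G1} \<and>
          subsemigroup_at (pm_class_semigroup G)
              (constituent (pm_class_semigroup G) (pm_class G S0)) (pm_class G S0)
            \<cong> cyclic_power 2 (r + t))"
proof (intro conjI ballI allI impI)
  let ?C = "pm_class_semigroup G"
  note G_facts = iso_two_four_structure[OF assms(1,3)]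
  interpret exponent_four_group G by (rule G_facts(2))

  show "pm_class G S \<in> idempotents ?C \<longleftrightarrow> S \<in> pm_zero_sum G"
    and "S \<in> pm_zero_sum G \<longleftrightarrow> subgroup (pm_sums G S) (G\<lparr>carrier := doubles G\<rparr>)"
    if "S \<in> carrier (seq_monoid G)" for S
    using that pm_class_idempotent_iff pm_zero_sum_iff_subgroup by auto

  show "rees_le ?C (pm_class G S1) (pm_class G S2) \<longleftrightarrow> pm_sums G S1 \<supseteq> pm_sums G S2"
    and "constituent ?C (pm_class G S1) = constituent ?C (pm_class G S2) \<longleftrightarrow> pm_sums G S1 = pm_sums G S2"
    if "S1 \<in> pm_zero_sum G" "S2 \<in> pm_zero_sum G" for S1 S2
    using that by (rule rees_le_pm_class_iff, rule constituent_pm_class_eq_iff)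

  show "clifford_semigroup ?C"
    by (rule clifford_pm_class_semigroup[OF G_facts(1)])
  show "{constituent ?C (pm_class G S) | S. S \<in> pm_zero_sum G} = {constituent ?C e | e. e \<in> idempotents ?C}"
    unfolding idempotents_pm_class_semigroup by blast

  fix G1 gs S0
  assume "subgroup G1 (G\<lparr>carrier := doubles G\<rparr>) \<and> set gs \<subseteq> carrier G \<and>
    is_basis (G\<lparr>carrier := G1\<rparr>) (map (\<lambda>g. g \<otimes>\<^bsub>G\<^esub> g) gs) \<and> S0 = (\<Sum>g\<leftarrow>gs. replicate_mset 2 g)"
  then have G1: "subgroup G1 (G\<lparr>carrier := doubles G\<rparr>)" and gs: "set gs \<subseteq> carrier G"
    and basis: "is_basis (G\<lparr>carrier := G1\<rparr>) (map (\<lambda>g. g \<otimes>\<^bsub>G\<^esub> g) gs)"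
    and S0: "S0 = (\<Sum>g\<leftarrow>gs. replicate_mset 2 g)"
    by auto
  have gen: "generate (G\<lparr>carrier := G1\<rparr>) ((\<lambda>g. g \<otimes>\<^bsub>G\<^esub> g) ` set gs) = G1"
    using basis by (simp add: is_basis_def)
  show zero_sum: "S0 \<in> pm_zero_sum G" and sums: "pm_sums G S0 = G1"
    unfolding S0 using pm_sums_squares_of_generators[OF G1 gs gen] by simp_all
  show "constituent ?C (pm_class G S0)
      = pm_class G S0 <#\<^bsub>?C\<^esub> {pm_class G {#g#} | g. g \<in> carrier G \<and> g \<otimes>\<^bsub>G\<^esub> g \<in> G1}"
    by (rule constituent_eq_coset[OF zero_sum sums])
  show "subsemigroup_at ?C (constituent ?C (pm_class G S0)) (pm_class G S0) \<cong> cyclic_power 2 (r + t)"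
    by (rule constituent_iso[OF zero_sum sums G_facts(1,3)])
qed

end
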